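(* Let $\Gamma\le\mathcal{S}_n$ act imprimitively, i.e. the permutation action of $\Gamma$ on $[n]$ preserves a block system with blocks of size $S$, where $1<S<n$. If $k\in\mathbb{Z}$ is not a multiple of $S$, then $\Gamma$ has infinitely many core points in the layer $\mathbb{Z}^n_{(k)}$.
   Context: $\mathcal{S}_n$ is the symmetric group on $[n]=\{1,\dots,n\}$; a subgroup $\Gamma\le\mathcal{S}_n$ acts on $\mathbb{R}^n$ by permuting coordinates. That $\Gamma$ preserves a block system with blocks of size $S$ means: there is a partition $[n]=\bigsqcup_{i=1}^{B}\Omega_i$ with $|\Omega_i|=S=n/B$ for all $i$, such that for every $\gamma\in\Gamma$ and every $i$ there is $j$ with $\gamma\Omega_i=\Omega_j$. A point $z\in\mathbb{Z}^n$ is a core point with respect to $\Gamma$ if $\operatorname{conv}(\Gamma z)\cap\mathbb{Z}^n=\Gamma z$. The layer with index $k$ is $\mathbb{Z}^n_{(k)}=\{x\in\mathbb{Z}^n : \sum_{i=1}^n x_i=k\}$. *)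

theory Defs
  imports "HOL-Analysis.Analysis" "HOL-Algebra.Bij" "HOL-Library.Disjoint_Sets"
begin

text \<open>
  The index set \<open>[n]\<close> is rendered by a finite type \<open>'n\<close> with \<open>n = CARD('n)\<close>, and the symmetric
  group by the group \<open>BijGroup UNIV\<close> of all bijections of \<open>'n\<close>.
\<close>

text \<open>
  Left action by permuting coordinates: the basis vector with index \<open>i\<close> is sent to the one with
  index \<open>\<gamma> i\<close>, hence the inverse on indices.
\<close>

definition perm_act :: "('n \<Rightarrow> 'n) \<Rightarrow> real ^ 'n \<Rightarrow> real ^ 'n::finite" where
  "perm_act \<gamma> x = (\<chi> i. x $ (inv_into UNIV \<gamma> i))"

definition perm_orbit :: "('n \<Rightarrow> 'n) set \<Rightarrow> real ^ 'n \<Rightarrow> (real ^ 'n::finite) set" where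
  "perm_orbit \<Gamma> z = (\<lambda>\<gamma>. perm_act \<gamma> z) ` \<Gamma>"

definition int_lattice :: "(real ^ 'n::finite) set" where
  "int_lattice = {x. \<forall>i. x $ i \<in> \<int>}"

definition layer :: "int \<Rightarrow> (real ^ 'n::finite) set" where
  "layer k = {x \<in> int_lattice. (\<Sum>i\<in>UNIV. x $ i) = real_of_int k}"

definition core_point :: "('n \<Rightarrow> 'n) set \<Rightarrow> real ^ 'n::finite \<Rightarrow> bool" where
  "core_point \<Gamma> z \<longleftrightarrow>
     z \<in> int_lattice \<and> convex hull (perm_orbit \<Gamma> z) \<inter> int_lattice = perm_orbit \<Gamma> z"

text \<open>
  The number of blocks is not a parameter: it is \<open>card \<P>\<close>, and \<open>S * card \<P> = CARD('n)\<close> follows.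
\<close>

definition preserves_block_system :: "('n::finite \<Rightarrow> 'n) set \<Rightarrow> nat \<Rightarrow> bool" where
  "preserves_block_system \<Gamma> S \<longleftrightarrow>
     (\<exists>\<P>. partition_on UNIV \<P> \<and> (\<forall>\<Omega>\<in>\<P>. card \<Omega> = S) \<and> (\<forall>\<gamma>\<in>\<Gamma>. \<forall>\<Omega>\<in>\<P>. \<gamma> ` \<Omega> \<in> \<P>))"

end

theory Submission
  imports Defs
begin

text \<open>
  Write \<open>k = q S + r\<close> with \<open>0 < r < S\<close>. Let \<open>z\<close> take the value \<open>p + 1\<close> on \<open>r\<close> points of one
  block \<open>\<Omega>\<^sub>1\<close>, the value \<open>p\<close> on the rest of \<open>\<Omega>\<^sub>1\<close>, and \<open>b\<close> elsewhere, where
  \<open>p = q - (B - 1) b\<close> puts \<open>z\<close> into layer \<open>k\<close> and \<open>b\<close> is an arbitrary integer. An integral point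
  \<open>x\<close> of \<open>conv (\<Gamma> z)\<close> cannot be constant on every block, since \<open>S\<close> does not divide \<open>k\<close>; so
  \<open>x\<^sub>i - x\<^sub>j \<ge> 1\<close> for some \<open>i, j\<close> in a common block \<open>\<Omega>\<close>. On the orbit this difference is at most
  \<open>1\<close>, and it is \<open>1\<close> only if \<open>\<gamma> \<Omega>\<^sub>1 = \<Omega>\<close>. Hence all orbit points used by \<open>x\<close> equal \<open>b\<close> off
  \<open>\<Omega>\<close> and are \<open>p\<close> or \<open>p + 1\<close> on \<open>\<Omega>\<close>; as \<open>x\<close> is integral, they all coincide with \<open>x\<close>.
\<close>

text \<open>The terms \<open>u w * (M - f w)\<close> are nonnegative and their sum is
  \<open>M\<close> minus the mean, which is at most 0, so each of them vanishes.\<close>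

lemma weighted_mean_ge_bound_imp_eq:
  fixes u f :: "'a \<Rightarrow> real"
  assumes "finite s" and "\<And>v. v \<in> s \<Longrightarrow> 0 \<le> u v" and "sum u s = 1"
    and le: "\<And>v. v \<in> s \<Longrightarrow> 0 < u v \<Longrightarrow> f v \<le> M"
    and "M \<le> (\<Sum>v\<in>s. u v * f v)"
  shows "(\<Sum>v\<in>s. u v * f v) = M"
    and "\<And>v. v \<in> s \<Longrightarrow> 0 < u v \<Longrightarrow> f v = M"
proof -
  have nonneg: "0 \<le> u w * (M - f w)" if "w \<in> s" for w
    using assms(2)[OF that] le[OF that] by (cases "u w = 0") auto
  have mean: "(\<Sum>w\<in>s. u w * (M - f w)) = M - (\<Sum>w\<in>s. u w * f w)"
    using assms(3) by (simp add: right_diff_distrib sum_subtractf flip: sum_distrib_right)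
  then have zero: "(\<Sum>w\<in>s. u w * (M - f w)) = 0"
    using assms(5) sum_nonneg[of s "\<lambda>w. u w * (M - f w)"] nonneg by fastforce
  then show "(\<Sum>v\<in>s. u v * f v) = M"
    using mean by simp
  fix v assume v: "v \<in> s" "0 < u v"
  then have "u v * (M - f v) = 0"
    using zero sum_nonneg_eq_0_iff[of s "\<lambda>w. u w * (M - f w)"] nonneg assms(1) by blast
  then show "f v = M"
    using v by simp
qed

text \<open>No integer lies strictly between \<open>m\<close> and \<open>m + 1\<close>, so the mean
  is at an end of the interval. There the extremal case applies, to \<open>- f\<close> at the lower
  end and to \<open>f\<close> at the upper one.\<close>

lemma weighted_mean_integral_imp_eq:
  fixes u f :: "'a \<Rightarrow> real" and m :: int
  assumes s: "finite s" "\<And>v. v \<in> s \<Longrightarrow> 0 \<le> u v" "sum u s = 1"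
    and lo: "\<And>v. v \<in> s \<Longrightarrow> 0 < u v \<Longrightarrow> of_int m \<le> f v"
    and hi: "\<And>v. v \<in> s \<Longrightarrow> 0 < u v \<Longrightarrow> f v \<le> of_int m + 1"
    and "(\<Sum>v\<in>s. u v * f v) \<in> \<int>"
    and v: "v \<in> s" "0 < u v"
  shows "f v = (\<Sum>v\<in>s. u v * f v)"
proof -
  obtain a where a: "(\<Sum>v\<in>s. u v * f v) = of_int a"
    using assms(6) by (auto elim: Ints_cases)
  consider "a \<le> m" | "m + 1 \<le> a" by linarith
  then show ?thesis
  proof cases
    case 1
    then have "- of_int m \<le> (\<Sum>w\<in>s. u w * - f w)"
      using a by (simp add: sum_negf)
    note mean = weighted_mean_ge_bound_imp_eq[OF s _ this]
    have "(\<Sum>w\<in>s. u w * - f w) = - of_int m" and "- f v = - of_int m"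
      using mean lo v by auto
    then show ?thesis
      by (simp add: sum_negf)
  next
    case 2
    then have "real_of_int (m + 1) \<le> of_int a"
      by (simp only: of_int_le_iff)
    then have "of_int m + 1 \<le> (\<Sum>w\<in>s. u w * f w)"
      using a by simp
    from weighted_mean_ge_bound_imp_eq[OF s hi this] v show ?thesis
      by simp
  qed
qed

text \<open>Each block contributes \<open>S\<close> times its common integer value to the coordinate
  sum.\<close>

lemma dvd_layer_if_constant_on_blocks:
  fixes x :: "real ^ 'n::finite"
  assumes "partition_on UNIV \<P>" and "\<And>\<Omega>. \<Omega> \<in> \<P> \<Longrightarrow> card \<Omega> = S"
    and "x \<in> layer k"
    and const: "\<And>\<Omega> i j. \<Omega> \<in> \<P> \<Longrightarrow> i \<in> \<Omega> \<Longrightarrow> j \<in> \<Omega> \<Longrightarrow> x $ i = x $ j"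
  shows "int S dvd k"
proof -
  have "\<exists>a::int. (\<Sum>i\<in>\<Omega>. x $ i) = of_int (int S * a)" if \<Omega>: "\<Omega> \<in> \<P>" for \<Omega>
  proof -
    obtain i where i: "i \<in> \<Omega>"
      using assms(1) \<Omega> by (metis all_not_in_conv partition_onD3)
    obtain a where a: "x $ i = of_int a"
      using assms(3) by (auto simp: layer_def int_lattice_def elim: Ints_cases)
    have "(\<Sum>j\<in>\<Omega>. x $ j) = (\<Sum>j\<in>\<Omega>. of_int a)"
      using const[OF \<Omega> _ i] a by simp
    then show ?thesis
      using assms(2)[OF \<Omega>] by (intro exI[of _ a]) simp
  qed
  then obtain g :: "'n set \<Rightarrow> int"
    where g: "\<And>\<Omega>. \<Omega> \<in> \<P> \<Longrightarrow> (\<Sum>i\<in>\<Omega>. x $ i) = of_int (int S * g \<Omega>)"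
    by metis
  have "of_int k = (\<Sum>i\<in>\<Union>\<P>. x $ i)"
    using assms(1,3) by (simp add: layer_def partition_on_def)
  also have "\<dots> = (\<Sum>\<Omega>\<in>\<P>. \<Sum>i\<in>\<Omega>. x $ i)"
    using assms(1) by (subst sum.Union_disjoint) (auto simp: partition_on_def disjoint_def)
  also have "\<dots> = of_int (int S * (\<Sum>\<Omega>\<in>\<P>. g \<Omega>))"
    by (simp add: g sum_distrib_left)
  finally show ?thesis
    by (metis dvd_triv_left of_int_eq_iff)
qed

text \<open>The two levels are \<open>p\<close> and \<open>p + 1\<close> on the block;
  \<open>b\<close> is the background. Keeping both sets as parameters makes the family closed under
  permutations of coordinates.\<close>

definition two_level_vec :: "'n set \<Rightarrow> 'n set \<Rightarrow> int \<Rightarrow> int \<Rightarrow> real ^ 'n::finite" where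
  "two_level_vec \<Omega> R p b =
     (\<chi> i. of_int (if i \<in> R then p + 1 else if i \<in> \<Omega> then p else b))"

lemma perm_act_two_level_vec:
  assumes "bij \<gamma>"
  shows "perm_act \<gamma> (two_level_vec \<Omega> R p b) = two_level_vec (\<gamma> ` \<Omega>) (\<gamma> ` R) p b"
proof -
  have "inv_into UNIV \<gamma> i \<in> A \<longleftrightarrow> i \<in> \<gamma> ` A" for i A
    using assms by (metis bij_inv_eq_iff bij_is_inj inj_image_mem_iff)
  then show ?thesis
    by (simp add: perm_act_def two_level_vec_def vec_eq_iff)
qed

lemma two_level_vec_in_layer:
  assumes "R \<subseteq> \<Omega>" and "k = int (CARD('n)) * b + int (card \<Omega>) * (p - b) + int (card R)"
  shows "two_level_vec \<Omega> R p b \<in> (layer k :: (real ^ 'n::finite) set)"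
proof -
  have "two_level_vec \<Omega> R p b $ i
      = of_int b + of_int (p - b) * indicator \<Omega> i + indicator R i" for i :: 'n
    using assms(1) by (auto simp: two_level_vec_def indicator_def)
  then have "(\<Sum>i\<in>UNIV. two_level_vec \<Omega> R p b $ i) = real_of_int k"
    using assms(2)
    by (simp add: sum.distrib indicator_def sum.If_cases flip: sum_distrib_left)
  then show ?thesis
    by (simp add: layer_def int_lattice_def two_level_vec_def)
qed

lemma perm_act_layer:
  assumes "bij \<gamma>" and "x \<in> layer k"
  shows "perm_act \<gamma> x \<in> layer k"
  using assms sum.reindex_bij_betw[OF bij_imp_bij_inv[OF assms(1)], of "\<lambda>i. x $ i"]
  by (simp add: layer_def int_lattice_def perm_act_def)

text \<open>Here \<open>p\<close> and \<open>b\<close> are tied together only through the layer, so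
  one statement covers the whole infinite family.\<close>

lemma core_point_two_level_vec:
  fixes \<Gamma> :: "('n::finite \<Rightarrow> 'n) set"
  assumes bij: "\<And>\<gamma>. \<gamma> \<in> \<Gamma> \<Longrightarrow> bij \<gamma>"
    and part: "partition_on UNIV \<P>" and card: "\<And>\<Omega>. \<Omega> \<in> \<P> \<Longrightarrow> card \<Omega> = S"
    and blocks: "\<And>\<gamma> \<Omega>. \<gamma> \<in> \<Gamma> \<Longrightarrow> \<Omega> \<in> \<P> \<Longrightarrow> \<gamma> ` \<Omega> \<in> \<P>"
    and \<Omega>\<^sub>1: "\<Omega>\<^sub>1 \<in> \<P>" and R: "R \<subseteq> \<Omega>\<^sub>1"
    and layer: "two_level_vec \<Omega>\<^sub>1 R p b \<in> layer k" and ndvd: "\<not> int S dvd k"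
  shows "core_point \<Gamma> (two_level_vec \<Omega>\<^sub>1 R p b)"
proof -
  define z where "z = two_level_vec \<Omega>\<^sub>1 R p b"
  define Q where "Q = perm_orbit \<Gamma> z"
  have fin: "finite Q"
    by (simp add: Q_def perm_orbit_def)
  have orbit: "\<exists>\<gamma>\<in>\<Gamma>. w = two_level_vec (\<gamma> ` \<Omega>\<^sub>1) (\<gamma> ` R) p b" if "w \<in> Q" for w
    using that bij by (auto simp: Q_def perm_orbit_def z_def perm_act_two_level_vec)
  have orbit_layer: "w \<in> layer k" if "w \<in> Q" for w
    using that bij layer by (auto simp: Q_def perm_orbit_def z_def intro: perm_act_layer)
  have "x \<in> Q" if hull: "x \<in> convex hull Q" and int: "x \<in> int_lattice" for x
  proof -
    \<comment> \<open>The weights range over the whole finite orbit and may vanish, so later claims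
      are restricted to points with \<open>0 < u v\<close>.\<close>
    obtain u where u0: "\<And>v. v \<in> Q \<Longrightarrow> 0 \<le> u v" and u1: "sum u Q = 1"
      and "(\<Sum>v\<in>Q. u v *\<^sub>R v) = x"
      using hull by (auto simp: convex_hull_finite[OF fin])
    then have x: "x $ i = (\<Sum>v\<in>Q. u v * v $ i)" for i
      by (auto simp: sum_component)
    have "(\<Sum>i\<in>UNIV. x $ i) = (\<Sum>v\<in>Q. u v * (\<Sum>i\<in>UNIV. v $ i))"
      unfolding x sum_distrib_left by (rule sum.swap)
    also have "\<dots> = of_int k"
      using orbit_layer u1 by (simp add: layer_def flip: sum_distrib_right)
    finally have "x \<in> layer k"
      using int by (simp add: layer_def)
    then obtain \<Omega> i j where \<Omega>: "\<Omega> \<in> \<P>" "i \<in> \<Omega>" "j \<in> \<Omega>" and "x $ i \<noteq> x $ j"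
      using dvd_layer_if_constant_on_blocks[OF part card] ndvd by metis
    then obtain i j where ij: "i \<in> \<Omega>" "j \<in> \<Omega>" "x $ j < x $ i"
      by (metis linorder_neqE_linordered_idom)
    obtain a c where "x $ i = of_int a" "x $ j = of_int c"
      using int by (auto simp: int_lattice_def elim!: Ints_cases) (metis Ints_cases)
    with ij(3) have "1 \<le> x $ i - x $ j"
      by auto
    \<comment> \<open>The integral gap becomes a lower bound on a weighted mean of differences, each
      of which is at most 1.\<close>
    then have ge1: "1 \<le> (\<Sum>v\<in>Q. u v * (v $ i - v $ j))"
      by (simp add: x right_diff_distrib sum_subtractf)
    have eq_or_disj: "\<gamma> ` \<Omega>\<^sub>1 = \<Omega> \<or> \<gamma> ` \<Omega>\<^sub>1 \<inter> \<Omega> = {}" if "\<gamma> \<in> \<Gamma>" for \<gamma>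
      using disjointD[OF partition_onD2[OF part] blocks[OF that \<Omega>\<^sub>1] \<Omega>(1)] by blast
    have "v $ i - v $ j \<le> 1" if v: "v \<in> Q" for v
    proof -
      obtain \<gamma> where "\<gamma> \<in> \<Gamma>" and "v = two_level_vec (\<gamma> ` \<Omega>\<^sub>1) (\<gamma> ` R) p b"
        using orbit[OF v] by auto
      then show ?thesis
        using eq_or_disj[of \<gamma>] R ij(1,2) by (auto simp: two_level_vec_def)
    qed
    then have diff: "v $ i - v $ j = 1" if "v \<in> Q" "0 < u v" for v
      using weighted_mean_ge_bound_imp_eq[OF fin u0 u1 _ ge1] that by blast
    have supp: "\<exists>\<gamma>\<in>\<Gamma>. v = two_level_vec \<Omega> (\<gamma> ` R) p b \<and> \<gamma> ` R \<subseteq> \<Omega>" if v: "v \<in> Q" "0 < u v" for v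
    proof -
      obtain \<gamma> where \<gamma>: "\<gamma> \<in> \<Gamma>" "v = two_level_vec (\<gamma> ` \<Omega>\<^sub>1) (\<gamma> ` R) p b"
        using orbit[OF v(1)] by auto
      \<comment> \<open>Otherwise both coordinates would equal \<open>b\<close> and their difference
        would be 0 instead of 1.\<close>
      have "\<gamma> ` \<Omega>\<^sub>1 \<inter> \<Omega> \<noteq> {}"
      proof
        assume "\<gamma> ` \<Omega>\<^sub>1 \<inter> \<Omega> = {}"
        then have "i \<notin> \<gamma> ` \<Omega>\<^sub>1" "j \<notin> \<gamma> ` \<Omega>\<^sub>1" "i \<notin> \<gamma> ` R" "j \<notin> \<gamma> ` R"
          using R ij(1,2) by blast+
        then show False
          using diff[OF v] \<gamma>(2) by (simp add: two_level_vec_def)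
      qed
      then have "\<gamma> ` \<Omega>\<^sub>1 = \<Omega>"
        using eq_or_disj[OF \<gamma>(1)] by blast
      then show ?thesis
        using \<gamma> R by blast
    qed
    \<comment> \<open>The unit interval starts at \<open>p\<close> on the block and at
      \<open>b\<close> off it, where the value is constantly \<open>b\<close>.\<close>
    have "v $ l = x $ l" if v: "v \<in> Q" "0 < u v" for v l
      unfolding x
    proof (rule weighted_mean_integral_imp_eq[OF fin u0 u1, where m = "if l \<in> \<Omega> then p else b"])
      show "(\<Sum>v\<in>Q. u v * v $ l) \<in> \<int>"
        using int by (simp add: int_lattice_def flip: x)
    next
      fix w assume "w \<in> Q" "0 < u w"
      then obtain R' where "w = two_level_vec \<Omega> R' p b" "R' \<subseteq> \<Omega>"
        using supp by blast
      then show "of_int (if l \<in> \<Omega> then p else b) \<le> w $ l"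
        and "w $ l \<le> of_int (if l \<in> \<Omega> then p else b) + 1"
        by (auto simp: two_level_vec_def)
    qed (use v in auto)
    \<comment> \<open>The weights sum to 1, so one is positive; its orbit point agrees with
      \<open>x\<close> in every coordinate.\<close>
    moreover obtain v where "v \<in> Q" "0 < u v"
      using u0 u1 by (metis less_eq_real_def sum.neutral zero_neq_one)
    ultimately show ?thesis
      by (metis vec_eq_iff)
  qed
  moreover have "Q \<subseteq> int_lattice"
    using orbit_layer by (auto simp: layer_def)
  moreover have "z \<in> int_lattice"
    using layer by (simp add: z_def layer_def)
  ultimately show ?thesis
    unfolding core_point_def z_def[symmetric] Q_def[symmetric] by (auto intro: hull_inc)
qed

theorem theorem28:
  fixes \<Gamma> :: "('n::finite \<Rightarrow> 'n) set" and S :: nat and k :: int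
  assumes "subgroup \<Gamma> (BijGroup (UNIV :: 'n set))"
    and "preserves_block_system \<Gamma> S"
    and "1 < S" and "S < CARD('n)"
    and "\<not> int S dvd k"
  shows "infinite {z \<in> layer k. core_point \<Gamma> z}"
proof -
  obtain \<P> where part: "partition_on UNIV \<P>" and card: "\<And>\<Omega>. \<Omega> \<in> \<P> \<Longrightarrow> card \<Omega> = S"
    and blocks: "\<And>\<gamma> \<Omega>. \<gamma> \<in> \<Gamma> \<Longrightarrow> \<Omega> \<in> \<P> \<Longrightarrow> \<gamma> ` \<Omega> \<in> \<P>"
    using assms(2) unfolding preserves_block_system_def by blast
  have bij: "bij \<gamma>" if "\<gamma> \<in> \<Gamma>" for \<gamma>
    using subgroup.subset[OF assms(1)] that by (auto simp: BijGroup_def Bij_def)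
  obtain \<Omega> where \<Omega>: "\<Omega> \<in> \<P>"
    using part by (auto simp: partition_on_def)
  \<comment> \<open>A coordinate outside the block exists since \<open>S < CARD('n)\<close>. It
    carries the value \<open>b\<close>, which makes \<open>z\<close> injective.\<close>
  obtain t where t: "t \<notin> \<Omega>"
    using card[OF \<Omega>] assms(4) by (metis UNIV_eq_I less_irrefl)
  have "nat (k mod int S) \<le> card \<Omega>"
    using card[OF \<Omega>] assms(3) by (simp add: nat_le_iff less_imp_le)
  then obtain R where R: "R \<subseteq> \<Omega>" "card R = nat (k mod int S)"
    by (meson obtain_subset_with_card_n)
  define B where "B = int (card \<P>)"
  have n: "int (CARD('n)) = B * int S"
    using card product_partition[OF part] by (simp add: B_def)
  \<comment> \<open>Raising \<open>b\<close> by 1 adds \<open>S\<close> on each of the other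
    \<open>B - 1\<close> blocks; lowering the level on \<Omega> by \<open>B - 1\<close> compensates
    for this.\<close>
  define z :: "int \<Rightarrow> real ^ 'n" where
    "z b = two_level_vec \<Omega> R (k div int S - (B - 1) * b) b" for b
  have layer: "z b \<in> layer k" for b
    unfolding z_def
  proof (rule two_level_vec_in_layer[OF R(1)])
    have "k = int S * (k div int S) + k mod int S"
      by simp
    also have "\<dots> = int (CARD('n)) * b + int (card \<Omega>) * (k div int S - (B - 1) * b - b) + int (card R)"
      using assms(3) by (simp add: n card[OF \<Omega>] R(2) algebra_simps)
    finally show "k = \<dots>" .
  qed
  have "core_point \<Gamma> (z b)" for b
    using core_point_two_level_vec[OF bij part card blocks \<Omega> R(1) _ assms(5)] layer[of b]
    by (simp add: z_def)
  then have "range z \<subseteq> {z \<in> layer k. core_point \<Gamma> z}"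
    using layer by auto
  moreover have "inj z"
  proof (rule injI)
    fix b b' assume "z b = z b'"
    then have "z b $ t = z b' $ t"
      by simp
    then show "b = b'"
      using t R(1) by (auto simp: z_def two_level_vec_def split: if_splits)
  qed
  ultimately show ?thesis
    using infinite_UNIV_int by (metis finite_imageD finite_subset)
qed

end
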